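(* Let $\mathcal{R}:\mathbb{R}^{I_T}\to\mathbb{R}^{I_T}$ be the space-time residual $$\mathcal{R}(u)_j^n:=\begin{cases}\dfrac{u_j^n-u_j^{n-1}}{\Delta t}+\mathcal{H}(x_j,u_j^n,\nabla_G u_j^n),&(j,n)\in\mathcal{J}\times\{1,\dots,N\},\\[4pt] \lambda_b(u_j^n-g_j^n),&(j,n)\in\mathcal{B}\times\{1,\dots,N\},\\ \lambda_0(u_j^0-g_j^0),&(j,n)\in\mathcal{J}\times\{0\},\end{cases}$$ with constants $\lambda_b,\lambda_0>0$, assume that $\mathcal{H}$ satisfies (H1) and (H2), and let $\bar u$ be the unique solution of $\mathcal{R}(\bar u)=0$. Then: (i) for any $u\in\mathbb{R}^{I_T}$ and $0\le n\le N$, $$\|u^n-\bar u^n\|_{\ell^\infty(V)}\le\max\Big(\|u^0-g^0\|_{\ell^\infty(\mathcal{J})},\ \max_{1\le k\le n}\|u^k-g^k\|_{\ell^\infty(\mathcal{B})}\Big)+\sum_{k=1}^n\Delta t\,\|\mathcal{R}(u)^k\|_{\ell^\infty(\mathcal{J})}$$ (for $n=0$ the norm on the left is over $\mathcal{J}$, and the maximum and the sum over $k$ are empty and omitted); (ii) if $\lambda_b>\frac1{\Delta t}$ and $$\frac{\Delta t}{\Delta x_{\min}}<\frac{1}{[\mathcal{H}]_p\max_j|\mathcal{V}_j'|},$$ then, setting $$\gamma:=\frac{1}{1-\frac{\Delta t}{\Delta x_{\min}}[\mathcal{H}]_p\max_j|\mathcal{V}_j'|},$$ for any $u\in\mathbb{R}^{I_T}$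 the one-step recursive estimate $$\|u^n-\bar u^n\|_{\ell^2(V)}\le\sqrt\gamma\,\Big(\|u^{n-1}-\bar u^{n-1}\|_{\ell^2(\mathcal{J})}+\Delta t\,\|\mathcal{R}(u)^n\|_{\ell^2(V)}\Big)$$ holds for every $1\le n\le N$.
   Context: Setting. $V$ is a finite index set, $\{x_j\}_{j\in V}$ are nodes which are the vertices of a directed graph; $\mathcal{V}_j\subset V$ is the set of (out-)neighbors of $j$, with $j\notin\mathcal{V}_j$. Put $\mathcal{J}:=\{j\in V:\mathcal{V}_j\neq\emptyset\}$ and $\mathcal{B}:=\{j\in V:\mathcal{V}_j=\emptyset\}$, both assumed non-empty. For $j\in V$, $\mathcal{V}_j':=\{i\in\mathcal{J}:j\in\mathcal{V}_i\}$, and $\max_j|\mathcal{V}_j'|$ is over $j\in V$. For $k\in\mathcal{V}_j$, $\Delta x_{jk}>0$ is the distance between $x_j$ and $x_k$; $\Delta x_{\min}:=\min_{j\in\mathcal{J},k\in\mathcal{V}_j}\Delta x_{jk}$. Time is discretized uniformly: $N\ge1$, $\Delta t=T/N$ with $T>0$, $t_n=n\Delta t$. The space-time index set is $I_T:=(\mathcal{J}\times\{0\})\cup(V\times\{1,\dots,N\})$; grid functions are $u=\{u_j^n\}_{(j,n)\in I_T}$, and $u^n$, $\mathcal{R}(u)^n$ denote the restrictions to time level $n$. For $j\in\mathcal{J}$, $n\ge1$, $\nabla_G u_j^n:=\{(u_j^n-u_k^n)/\Delta x_{jk}\}_{k\in\mathcal{V}_j}\in\mathbb{R}^{|\mathcal{V}_j|}$.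 For each $j\in\mathcal{J}$ a numerical Hamiltonian $\mathcal{H}(x_j,\cdot,\cdot):\mathbb{R}\times\mathbb{R}^{|\mathcal{V}_j|}\to\mathbb{R}$ is given, as are initial data $g_j^0$ ($j\in\mathcal{J}$) and boundary data $g_j^n$ ($j\in\mathcal{B}$, $1\le n\le N$). For $W\subset V$, $\|\cdot\|_{\ell^\infty(W)}$ and $\|\cdot\|_{\ell^2(W)}$ are the maximum and Euclidean norms over indices in $W$. Hypotheses. (H1) There are constants $[\mathcal{H}]_u,[\mathcal{H}]_p>0$, independent of $x_j$, such that $|\mathcal{H}(x_j,u,p)-\mathcal{H}(x_j,v,p)|\le[\mathcal{H}]_u|u-v|$ and $|\mathcal{H}(x_j,u,p)-\mathcal{H}(x_j,u,q)|\le[\mathcal{H}]_p\|p-q\|_\infty$ for all $j\in\mathcal{J}$, $u,v\in\mathbb{R}$, $p,q\in\mathbb{R}^{|\mathcal{V}_j|}$. (H2) For all $j\in\mathcal{J}$, $u,v\in\mathbb{R}$, $p,q\in\mathbb{R}^{|\mathcal{V}_j|}$: $p\le q$ componentwise implies $\mathcal{H}(x_j,u,p)\le\mathcal{H}(x_j,u,q)$; and $u\le v$ implies $\mathcal{H}(x_j,u,p)\le\mathcal{H}(x_j,v,p)$. Under these hypotheses $\mathcal{R}(\bar u)=0$ has exactly one solution $\bar u\in\mathbb{R}^{I_T}$. *)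

theory Defs
  imports "HOL-Analysis.L2_Norm" "HOL-Library.FuncSet"
begin

text \<open>
  The space of real vectors indexed by a finite set \<open>W\<close> is rendered as
  \<open>extensional W\<close>, i.e. real functions that are \<open>undefined\<close> outside \<open>W\<close>.
  The neighbourhood map is \<open>nb\<close>; \<open>dx j k\<close> is the distance from node \<open>j\<close> to its
  neighbour \<open>k\<close>, and only its values for \<open>k \<in> nb j\<close> are ever used.
\<close>

definition inner_nodes :: "'v set \<Rightarrow> ('v \<Rightarrow> 'v set) \<Rightarrow> 'v set" where
  "inner_nodes V nb = {j \<in> V. nb j \<noteq> {}}"

definition boundary_nodes :: "'v set \<Rightarrow> ('v \<Rightarrow> 'v set) \<Rightarrow> 'v set" where
  "boundary_nodes V nb = {j \<in> V. nb j = {}}"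

definition in_neighbors :: "'v set \<Rightarrow> ('v \<Rightarrow> 'v set) \<Rightarrow> 'v \<Rightarrow> 'v set" where
  "in_neighbors V nb j = {i \<in> inner_nodes V nb. j \<in> nb i}"

definition max_in_degree :: "'v set \<Rightarrow> ('v \<Rightarrow> 'v set) \<Rightarrow> nat" where
  "max_in_degree V nb = (MAX j\<in>V. card (in_neighbors V nb j))"

definition dx_min :: "'v set \<Rightarrow> ('v \<Rightarrow> 'v set) \<Rightarrow> ('v \<Rightarrow> 'v \<Rightarrow> real) \<Rightarrow> real" where
  "dx_min V nb dx = Min {dx j k | j k. j \<in> inner_nodes V nb \<and> k \<in> nb j}"

definition space_time_index :: "'v set \<Rightarrow> ('v \<Rightarrow> 'v set) \<Rightarrow> nat \<Rightarrow> ('v \<times> nat) set" where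
  "space_time_index V nb N = inner_nodes V nb \<times> {0} \<union> V \<times> {1..N}"

definition time_level :: "('v \<times> nat \<Rightarrow> real) \<Rightarrow> nat \<Rightarrow> 'v \<Rightarrow> real" where
  "time_level u n = (\<lambda>j. u (j, n))"

text \<open>The maximum norm over the indices in \<open>W\<close>, meaningful for finite non-empty \<open>W\<close>;
  the Euclidean norm is the library's \<open>L2_set\<close>.\<close>

definition linf_norm :: "'v set \<Rightarrow> ('v \<Rightarrow> real) \<Rightarrow> real" where
  "linf_norm W f = (MAX j\<in>W. \<bar>f j\<bar>)"

definition graph_gradient ::
  "('v \<Rightarrow> 'v set) \<Rightarrow> ('v \<Rightarrow> 'v \<Rightarrow> real) \<Rightarrow> ('v \<Rightarrow> real) \<Rightarrow> 'v \<Rightarrow> ('v \<Rightarrow> real)" where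
  "graph_gradient nb dx w j = (\<lambda>k\<in>nb j. (w j - w k) / dx j k)"

text \<open>\<open>H j\<close> is the numerical Hamiltonian at the node with index \<open>j\<close>; its last argument
  is only constrained, and only used, on \<open>extensional (nb j)\<close>.\<close>

definition hamiltonian_lipschitz ::
  "'v set \<Rightarrow> ('v \<Rightarrow> 'v set) \<Rightarrow> ('v \<Rightarrow> real \<Rightarrow> ('v \<Rightarrow> real) \<Rightarrow> real) \<Rightarrow> real \<Rightarrow> real \<Rightarrow> bool" where
  "hamiltonian_lipschitz V nb H Hu Hp \<longleftrightarrow>
     0 < Hu \<and> 0 < Hp \<and>
     (\<forall>j\<in>inner_nodes V nb. \<forall>u v. \<forall>p\<in>extensional (nb j).
        \<bar>H j u p - H j v p\<bar> \<le> Hu * \<bar>u - v\<bar>) \<and>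
     (\<forall>j\<in>inner_nodes V nb. \<forall>u. \<forall>p\<in>extensional (nb j). \<forall>q\<in>extensional (nb j).
        \<bar>H j u p - H j u q\<bar> \<le> Hp * linf_norm (nb j) (\<lambda>k. p k - q k))"

definition hamiltonian_monotone ::
  "'v set \<Rightarrow> ('v \<Rightarrow> 'v set) \<Rightarrow> ('v \<Rightarrow> real \<Rightarrow> ('v \<Rightarrow> real) \<Rightarrow> real) \<Rightarrow> bool" where
  "hamiltonian_monotone V nb H \<longleftrightarrow>
     (\<forall>j\<in>inner_nodes V nb. \<forall>u. \<forall>p\<in>extensional (nb j). \<forall>q\<in>extensional (nb j).
        (\<forall>k\<in>nb j. p k \<le> q k) \<longrightarrow> H j u p \<le> H j u q) \<and>
     (\<forall>j\<in>inner_nodes V nb. \<forall>u v. \<forall>p\<in>extensional (nb j).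
        u \<le> v \<longrightarrow> H j u p \<le> H j v p)"

text \<open>The data \<open>g\<close> is only read at \<open>(j, 0)\<close> for inner \<open>j\<close> and at \<open>(j, n)\<close>, \<open>1 \<le> n \<le> N\<close>,
  for boundary \<open>j\<close>.\<close>

definition residual ::
  "'v set \<Rightarrow> ('v \<Rightarrow> 'v set) \<Rightarrow> ('v \<Rightarrow> 'v \<Rightarrow> real) \<Rightarrow> ('v \<Rightarrow> real \<Rightarrow> ('v \<Rightarrow> real) \<Rightarrow> real) \<Rightarrow>
   ('v \<times> nat \<Rightarrow> real) \<Rightarrow> nat \<Rightarrow> real \<Rightarrow> real \<Rightarrow> real \<Rightarrow>
   ('v \<times> nat \<Rightarrow> real) \<Rightarrow> ('v \<times> nat \<Rightarrow> real)" where
  "residual V nb dx H g N dt lb l0 u =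
     restrict (\<lambda>(j, n).
       if n = 0 then l0 * (u (j, 0) - g (j, 0))
       else if j \<in> inner_nodes V nb then
         (u (j, n) - u (j, n - 1)) / dt + H j (u (j, n)) (graph_gradient nb dx (time_level u n) j)
       else lb * (u (j, n) - g (j, n)))
     (space_time_index V nb N)"

end

theory Submission imports Defs begin

text \<open>
  The implicit Euler step compares well with a monotone Hamiltonian: subtracting the equations
  for \<open>u\<close> and \<open>ubar\<close>, the error \<open>e = u - ubar\<close> satisfies, at every inner node,
  \<open>(e\<^sup>n - e\<^sup>n\<^sup>-\<^sup>1) / dt + D = R(u)\<^sup>n\<close>, where \<open>D\<close> is the difference of the two Hamiltonians.
  Both estimates rest on a single lower bound for \<open>D\<close>, \<open>hamiltonian_diff_lower\<close>: at a node with
  \<open>e\<^sub>j \<ge> 0\<close>, the difference \<open>D\<close> can be negative only through neighbours \<open>k\<close> with \<open>e\<^sub>k > e\<^sub>j\<close>, and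
  the Lipschitz condition bounds that contribution by the largest excess \<open>e\<^sub>k - e\<^sub>j\<close>.

  \<^item> For the maximum norm, look at a node where \<open>\<bar>e\<^sup>n\<bar>\<close> is largest. Up to exchanging \<open>u\<close> and \<open>ubar\<close> there is
    no excess there, so \<open>e \<cdot> D \<ge> 0\<close> and one step adds at most \<open>dt\<close> times the residual, unless the node lies on the
    boundary, where the error is the boundary defect (\<open>linf_step\<close>). Iterating in time gives (i).

  \<^item> For the Euclidean norm, multiply the error equation by \<open>e\<^sub>j\<close>. Since
    \<open>a (b - a) \<le> b\<^sup>2 / 4\<close>, the excess costs, up to the factor \<open>Hp / dx_min\<close>, at most a
    quarter of the squared error at the neighbours (\<open>hamiltonian_energy_lower\<close>). Summed over the inner nodes, each node is counted as often as its
    in-degree, so with \<open>c = dt Hp M / dx_min\<close>, \<open>M\<close> the maximal in-degree, the step satisfies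
    \<open>(1 - c/4) \<parallel>e\<^sup>n\<parallel> \<le> \<parallel>e\<^sup>n\<^sup>-\<^sup>1\<parallel> + dt \<parallel>R(u)\<^sup>n\<parallel>\<close>; the boundary terms fit in because
    \<open>lb > 1 / dt\<close>. Finally \<open>1 - c \<le> (1 - c/4)\<^sup>2\<close> turns the factor \<open>1 / (1 - c/4)\<close> into
    \<open>sqrt \<gamma>\<close> with \<open>\<gamma> = 1 / (1 - c)\<close> (\<open>L2_step\<close>).
\<close>

lemma abs_le_linf_norm: "finite W \<Longrightarrow> j \<in> W \<Longrightarrow> \<bar>f j\<bar> \<le> linf_norm W f"
  unfolding linf_norm_def by (intro Max_ge) auto

lemma linf_norm_leI:
  assumes "finite W" "W \<noteq> {}" "\<And>j. j \<in> W \<Longrightarrow> \<bar>f j\<bar> \<le> c"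
  shows "linf_norm W f \<le> c"
  unfolding linf_norm_def using assms by (subst Max_le_iff) auto

lemma linf_norm_attained:
  assumes "finite W" "W \<noteq> {}"
  obtains j where "j \<in> W" "linf_norm W f = \<bar>f j\<bar>"
proof -
  have "linf_norm W f \<in> (\<lambda>j. \<bar>f j\<bar>) ` W"
    unfolding linf_norm_def using assms by (intro Max_in) auto
  then show thesis using that by blast
qed

lemma linf_norm_cong: "(\<And>j. j \<in> W \<Longrightarrow> f j = h j) \<Longrightarrow> linf_norm W f = linf_norm W h"
  unfolding linf_norm_def by (auto intro!: arg_cong[where f = Max] image_cong)

lemma linf_norm_subset:
  "finite W \<Longrightarrow> A \<subseteq> W \<Longrightarrow> A \<noteq> {} \<Longrightarrow> linf_norm A f \<le> linf_norm W f"
  by (intro linf_norm_leI) (auto intro: abs_le_linf_norm finite_subset)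

lemma L2_set_subset: "finite W \<Longrightarrow> A \<subseteq> W \<Longrightarrow> L2_set f A \<le> L2_set f W"
  unfolding L2_set_def by (intro real_sqrt_le_mono sum_mono2) auto

lemma sum_mult_le_L2: "(\<Sum>i\<in>A. f i * h i) \<le> L2_set f A * L2_set h A"
proof -
  have "(\<Sum>i\<in>A. f i * h i) \<le> (\<Sum>i\<in>A. \<bar>f i\<bar> * \<bar>h i\<bar>)"
    by (intro sum_mono) (metis abs_ge_self abs_mult)
  also have "\<dots> \<le> L2_set f A * L2_set h A" by (rule L2_set_mult_ineq)
  finally show ?thesis .
qed

lemma mult_excess_le_quarter_square: "a * (b - a) \<le> (b\<^sup>2 :: real) / 4"
proof -
  have "0 \<le> (b / 2 - a)\<^sup>2" by simp
  then show ?thesis by (simp add: power2_eq_square field_simps)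
qed

locale monotone_graph_hamiltonian =
  fixes V :: "'v set" and nb :: "'v \<Rightarrow> 'v set" and dx :: "'v \<Rightarrow> 'v \<Rightarrow> real"
    and H :: "'v \<Rightarrow> real \<Rightarrow> ('v \<Rightarrow> real) \<Rightarrow> real" and Hu Hp :: real
  assumes finV: "finite V"
    and nb_subset: "\<And>j. j \<in> V \<Longrightarrow> nb j \<subseteq> V"
    and inner_nonempty: "inner_nodes V nb \<noteq> {}"
    and boundary_nonempty: "boundary_nodes V nb \<noteq> {}"
    and dx_pos: "\<And>j k. j \<in> inner_nodes V nb \<Longrightarrow> k \<in> nb j \<Longrightarrow> dx j k > 0"
    and lipschitz: "hamiltonian_lipschitz V nb H Hu Hp"
    and monotone: "hamiltonian_monotone V nb H"
begin

abbreviation J where "J \<equiv> inner_nodes V nb"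
abbreviation B where "B \<equiv> boundary_nodes V nb"
abbreviation ham where "ham w j \<equiv> H j (w j) (graph_gradient nb dx w j)"

lemma V_eq: "V = J \<union> B" and disjoint: "J \<inter> B = {}"
  unfolding inner_nodes_def boundary_nodes_def by auto

lemma finite_inner: "finite J" and finite_boundary: "finite B"
  using finV V_eq by (metis finite_Un)+

lemma Hp_pos: "0 < Hp"
  using lipschitz unfolding hamiltonian_lipschitz_def by auto

lemma inner_nb: "j \<in> J \<Longrightarrow> nb j \<subseteq> V" "j \<in> J \<Longrightarrow> finite (nb j)" "j \<in> J \<Longrightarrow> nb j \<noteq> {}"
  using nb_subset finite_subset[OF _ finV] unfolding inner_nodes_def by auto

lemma dx_min_le: "j \<in> J \<Longrightarrow> k \<in> nb j \<Longrightarrow> dx_min V nb dx \<le> dx j k"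
  and dx_min_pos: "0 < dx_min V nb dx"
proof -
  let ?S = "{dx j k | j k. j \<in> J \<and> k \<in> nb j}"
  have "?S = (\<lambda>(j, k). dx j k) ` (SIGMA j:J. nb j)" by auto
  then have fin: "finite ?S" using finite_inner inner_nb(2) by simp
  show "j \<in> J \<Longrightarrow> k \<in> nb j \<Longrightarrow> dx_min V nb dx \<le> dx j k"
    unfolding dx_min_def using fin by (intro Min_le) auto
  have "?S \<noteq> {}" using inner_nonempty inner_nb(3) by blast
  then show "0 < dx_min V nb dx"
    unfolding dx_min_def using fin dx_pos by (subst Min_gr_iff) auto
qed

section \<open>Lower bounds for the difference of Hamiltonians\<close>

text \<open>
  Lowering the gradient of \<open>w\<close> to the componentwise minimum with the gradient of \<open>v\<close> only lowers
  the Hamiltonian; this minimum differs from the gradient of \<open>v\<close> solely in the components where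
  the error \<open>w - v\<close> at the neighbour exceeds the one at \<open>j\<close>, and there by at most \<open>m / dx_min\<close>.
  The case \<open>m = 0\<close> is the discrete maximum principle.
\<close>

lemma hamiltonian_diff_lower:
  assumes j: "j \<in> J" and le: "v j \<le> w j" and m: "0 \<le> m"
    and excess: "\<And>k. k \<in> nb j \<Longrightarrow> (w k - v k) - (w j - v j) \<le> m"
  shows "ham v j - Hp * (m / dx_min V nb dx) \<le> ham w j"
proof -
  define p q where "p = graph_gradient nb dx w j" and "q = graph_gradient nb dx v j"
  define r where "r = restrict (\<lambda>k. min (p k) (q k)) (nb j)"
  have ext: "p \<in> extensional (nb j)" "q \<in> extensional (nb j)" "r \<in> extensional (nb j)"
    unfolding p_def q_def r_def graph_gradient_def by auto
  have "\<bar>r k - q k\<bar> \<le> m / dx_min V nb dx" if k: "k \<in> nb j" for k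
  proof -
    have d: "0 < dx j k" "dx_min V nb dx \<le> dx j k" using dx_pos dx_min_le j k by auto
    have "q k - p k = ((w k - v k) - (w j - v j)) / dx j k"
      using k unfolding p_def q_def graph_gradient_def by (simp add: diff_divide_distrib)
    also have "\<dots> \<le> m / dx j k"
      using excess[OF k] d by (intro divide_right_mono) auto
    also have "\<dots> \<le> m / dx_min V nb dx"
      using m d dx_min_pos by (intro divide_left_mono) auto
    finally have "q k - p k \<le> m / dx_min V nb dx" .
    moreover have "0 \<le> m / dx_min V nb dx" using m dx_min_pos by simp
    ultimately show ?thesis using k unfolding r_def by (auto simp: min_def)
  qed
  then have "linf_norm (nb j) (\<lambda>k. r k - q k) \<le> m / dx_min V nb dx"
    using inner_nb j by (intro linf_norm_leI) auto
  then have "Hp * linf_norm (nb j) (\<lambda>k. r k - q k) \<le> Hp * (m / dx_min V nb dx)"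
    using Hp_pos by (intro mult_left_mono) auto
  moreover have "\<bar>H j (v j) r - H j (v j) q\<bar> \<le> Hp * linf_norm (nb j) (\<lambda>k. r k - q k)"
    using lipschitz j ext unfolding hamiltonian_lipschitz_def by blast
  moreover have "\<forall>k\<in>nb j. r k \<le> p k" unfolding r_def by simp
  then have "H j (v j) r \<le> H j (v j) p"
    using monotone j ext unfolding hamiltonian_monotone_def by blast
  moreover have "H j (v j) p \<le> H j (w j) p"
    using monotone j ext le unfolding hamiltonian_monotone_def by blast
  ultimately show ?thesis unfolding p_def q_def by linarith
qed

text \<open>
  The Hamiltonians need not be dissipative for the Euclidean inner product, but the defect is
  controlled by the neighbours alone: with \<open>a\<close> the error at \<open>j\<close> and \<open>b\<close> the largest error at a
  neighbour, it is at most proportional to \<open>a (b - a) \<le> b\<^sup>2 / 4\<close>. The statement is symmetric in \<open>v\<close> and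
  \<open>w\<close>, which disposes of the sign of \<open>a\<close>.
\<close>

lemma hamiltonian_energy_lower:
  assumes j: "j \<in> J"
  shows "- (Hp / (4 * dx_min V nb dx)) * (\<Sum>k\<in>nb j. (w k - v k)\<^sup>2)
           \<le> (w j - v j) * (ham w j - ham v j)"
proof -
  have main: "- (Hp / (4 * dx_min V nb dx)) * (\<Sum>k\<in>nb j. (w k - v k)\<^sup>2)
           \<le> (w j - v j) * (ham w j - ham v j)" if le: "v j \<le> w j" for v w
  proof -
    let ?d = "dx_min V nb dx"
    let ?a = "w j - v j"
    let ?e = "\<lambda>k. w k - v k"
    have "Max (?e ` nb j) \<in> ?e ` nb j"
      using inner_nb j by (intro Max_in) auto
    then obtain k where k: "k \<in> nb j" and kmax: "Max (?e ` nb j) = ?e k" by auto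
    have le_k: "?e i \<le> ?e k" if "i \<in> nb j" for i
      unfolding kmax[symmetric] using that inner_nb j by (intro Max_ge) auto
    define m where "m = max 0 (?e k - ?a)"
    have "ham v j - Hp * (m / ?d) \<le> ham w j"
    proof (rule hamiltonian_diff_lower[where v = v and w = w, OF j le])
      show "0 \<le> m" unfolding m_def by simp
      show "?e i - ?a \<le> m" if "i \<in> nb j" for i
        using le_k[OF that] unfolding m_def by linarith
    qed
    then have "?a * (- (Hp * (m / ?d))) \<le> ?a * (ham w j - ham v j)"
      using le by (intro mult_left_mono) auto
    moreover have "?a * m \<le> (?e k)\<^sup>2 / 4"
      using mult_excess_le_quarter_square[of ?a "?e k"] unfolding m_def by (simp add: max_def)
    moreover have "(?e k)\<^sup>2 \<le> (\<Sum>k\<in>nb j. (?e k)\<^sup>2)"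
      using k inner_nb j by (intro member_le_sum) auto
    ultimately have *: "?a * m \<le> (\<Sum>k\<in>nb j. (?e k)\<^sup>2) / 4"
      and **: "- ((Hp / ?d) * (?a * m)) \<le> ?a * (ham w j - ham v j)"
      by (auto simp: field_simps)
    have "(Hp / ?d) * (?a * m) \<le> (Hp / ?d) * ((\<Sum>k\<in>nb j. (?e k)\<^sup>2) / 4)"
      using * Hp_pos dx_min_pos by (intro mult_left_mono) auto
    with ** show ?thesis by (simp add: field_simps)
  qed
  show ?thesis
  proof (cases "v j \<le> w j")
    case True then show ?thesis by (rule main)
  next
    case False
    then have "- (Hp / (4 * dx_min V nb dx)) * (\<Sum>k\<in>nb j. (v k - w k)\<^sup>2)
           \<le> (v j - w j) * (ham v j - ham w j)" by (intro main) simp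
    moreover have "(v j - w j) * (ham v j - ham w j) = (w j - v j) * (ham w j - ham v j)"
      by (simp add: algebra_simps)
    ultimately show ?thesis by (simp add: power2_commute)
  qed
qed

text \<open>Double counting of the edges: node \<open>k\<close> occurs once for each of its in-neighbours.\<close>

lemma sum_neighbors_le:
  assumes nonneg: "\<And>k. k \<in> V \<Longrightarrow> 0 \<le> f k"
  shows "(\<Sum>j\<in>J. \<Sum>k\<in>nb j. f k) \<le> real (max_in_degree V nb) * (\<Sum>k\<in>V. f k)"
proof -
  have "(\<Sum>j\<in>J. \<Sum>k\<in>nb j. f k) = (\<Sum>j\<in>J. \<Sum>k\<in>{k\<in>V. k \<in> nb j}. f k)"
    using inner_nb(1) by (intro sum.cong) auto
  also have "\<dots> = (\<Sum>k\<in>V. \<Sum>j\<in>{j\<in>J. k \<in> nb j}. f k)"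
    using finite_inner finV by (rule sum.swap_restrict)
  also have "\<dots> = (\<Sum>k\<in>V. real (card (in_neighbors V nb k)) * f k)"
    unfolding in_neighbors_def by simp
  also have "\<dots> \<le> (\<Sum>k\<in>V. real (max_in_degree V nb) * f k)"
    unfolding max_in_degree_def using finV nonneg
    by (intro sum_mono mult_right_mono) auto
  finally show ?thesis by (simp add: sum_distrib_left)
qed

section \<open>One implicit Euler step\<close>

text \<open>
  In both steps \<open>w\<close> and \<open>v\<close> are two grid functions at the new time level, \<open>e\<close> is their difference
  at the old level, and \<open>r\<close> is the difference of their residuals.
\<close>

lemma linf_step:
  assumes dt: "0 < dt"
    and step: "\<And>j. j \<in> J \<Longrightarrow> (w j - v j - e j) / dt + (ham w j - ham v j) = r j"
  shows "linf_norm V (\<lambda>j. w j - v j)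
           \<le> max (linf_norm B (\<lambda>j. w j - v j)) (linf_norm J e + dt * linf_norm J r)"
proof -
  have at_max: "w j - v j \<le> e j + dt * r j"
    if "j \<in> J" "v j \<le> w j" "\<And>k. k \<in> nb j \<Longrightarrow> w k - v k \<le> w j - v j"
      "(w j - v j - e j) / dt + (ham w j - ham v j) = r j"
    for v w e r :: "'v \<Rightarrow> real" and j
  proof -
    have "ham v j \<le> ham w j"
      using hamiltonian_diff_lower[of j v w 0] that by simp
    then have "(w j - v j - e j) / dt \<le> r j" using that(4) by linarith
    then show ?thesis using dt by (simp add: pos_divide_le_eq algebra_simps)
  qed
  have "V \<noteq> {}" using V_eq inner_nonempty by auto
  then obtain j where j: "j \<in> V" and norm: "linf_norm V (\<lambda>j. w j - v j) = \<bar>w j - v j\<bar>"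
    by (rule linf_norm_attained[OF finV])
  have le: "\<bar>w k - v k\<bar> \<le> \<bar>w j - v j\<bar>" if "k \<in> V" for k
    unfolding norm[symmetric] using abs_le_linf_norm[OF finV that, of "\<lambda>j. w j - v j"] .
  show ?thesis
  proof (cases "j \<in> J")
    case False
    then have "j \<in> B" using j V_eq by auto
    then show ?thesis
      using abs_le_linf_norm[OF finite_boundary, of j "\<lambda>j. w j - v j"] norm by auto
  next
    case True
    have nb: "k \<in> V" if "k \<in> nb j" for k using that inner_nb(1)[OF True] by auto
    have "\<bar>w j - v j\<bar> \<le> \<bar>e j\<bar> + dt * \<bar>r j\<bar>"
    proof (cases "v j \<le> w j")
      case pos: True
      have "w j - v j \<le> e j + dt * r j"
      proof (rule at_max[where v = v and w = w and e = e and r = r, OF True pos _ step[OF True]])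
        show "w k - v k \<le> w j - v j" if "k \<in> nb j" for k
          using le[OF nb[OF that]] pos by linarith
      qed
      also have "\<dots> \<le> \<bar>e j\<bar> + dt * \<bar>r j\<bar>" using dt by (intro add_mono mult_left_mono) auto
      finally show ?thesis using pos by simp
    next
      case neg: False
      \<comment> \<open>Exchanging \<open>v\<close> and \<open>w\<close> changes the sign of the error equation.\<close>
      have "v j - w j \<le> - e j + dt * (- r j)"
      proof (rule at_max[where v = w and w = v and e = "\<lambda>j. - e j" and r = "\<lambda>j. - r j",
              OF True])
        show "w j \<le> v j" using neg by simp
        show "v k - w k \<le> v j - w j" if "k \<in> nb j" for k
          using le[OF nb[OF that]] neg by linarith
        show "(v j - w j - - e j) / dt + (ham v j - ham w j) = - r j"
          using step[OF True, symmetric] by (simp add: diff_divide_distrib add_divide_distrib)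
      qed
      also have "\<dots> \<le> \<bar>e j\<bar> + dt * \<bar>r j\<bar>" using dt by (intro add_mono mult_left_mono) auto
      finally show ?thesis using neg by simp
    qed
    also have "\<dots> \<le> linf_norm J e + dt * linf_norm J r"
      using dt abs_le_linf_norm[OF finite_inner True] by (intro add_mono mult_left_mono) auto
    finally show ?thesis using norm by simp
  qed
qed

text \<open>
  Testing the error equation with the error \<open>x\<close> itself gives
  \<open>\<parallel>x\<parallel>\<^sup>2 \<le> \<parallel>x\<parallel> (\<parallel>e\<parallel> + dt \<parallel>r\<parallel>) + (c / 4) \<parallel>x\<parallel>\<^sup>2\<close>. On the boundary \<open>x\<^sub>j\<^sup>2 = x\<^sub>j r\<^sub>j / lb\<close>, which the
  residual term absorbs since \<open>lb > 1 / dt\<close>.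
\<close>

lemma L2_step:
  assumes dt: "0 < dt" and lb: "1 / dt < lb"
    and small: "dt / dx_min V nb dx < 1 / (Hp * real (max_in_degree V nb))"
    and step: "\<And>j. j \<in> J \<Longrightarrow> (w j - v j - e j) / dt + (ham w j - ham v j) = r j"
    and bdry: "\<And>j. j \<in> B \<Longrightarrow> lb * (w j - v j) = r j"
  shows "L2_set (\<lambda>j. w j - v j) V
           \<le> sqrt (1 / (1 - dt / dx_min V nb dx * Hp * real (max_in_degree V nb)))
              * (L2_set e J + dt * L2_set r V)"
proof -
  define x where "x j = w j - v j" for j
  define d where "d = dx_min V nb dx"
  define M where "M = real (max_in_degree V nb)"
  define c where "c = dt / d * Hp * M"
  define X where "X = L2_set x V"
  define Y where "Y = L2_set e J + dt * L2_set r V"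
  have d: "0 < d" unfolding d_def by (rule dx_min_pos)
  have c0: "0 \<le> c" unfolding c_def M_def using dt d Hp_pos by simp
  have "0 < dt / d" using dt d by simp
  then have "0 < Hp * M" using small unfolding d_def M_def
    by (metis order.strict_trans zero_less_divide_1_iff)
  then have c1: "c < 1"
    using small unfolding c_def d_def M_def by (simp add: pos_less_divide_eq mult.assoc)
  have X0: "0 \<le> X" and Y0: "0 \<le> Y" unfolding X_def Y_def using dt by (auto simp: L2_set_nonneg)
  have X2: "X\<^sup>2 = (\<Sum>j\<in>V. (x j)\<^sup>2)"
    unfolding X_def L2_set_def by (simp add: sum_nonneg)
  have inner: "(x j)\<^sup>2 \<le> x j * e j + dt * (x j * r j) + dt * Hp / (4 * d) * (\<Sum>k\<in>nb j. (x k)\<^sup>2)"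
    if j: "j \<in> J" for j
  proof -
    have "x j - e j + dt * (ham w j - ham v j) = dt * r j"
      using step[OF j, symmetric] dt unfolding x_def by (simp add: field_simps)
    then have "x j * (x j - e j + dt * (ham w j - ham v j)) = x j * (dt * r j)" by simp
    moreover have "dt * (- (Hp / (4 * d)) * (\<Sum>k\<in>nb j. (x k)\<^sup>2))
                    \<le> dt * (x j * (ham w j - ham v j))"
      unfolding x_def d_def using dt
      by (intro mult_left_mono hamiltonian_energy_lower[OF j]) auto
    ultimately show ?thesis by (simp add: algebra_simps power2_eq_square)
  qed
  have boundary: "(x j)\<^sup>2 \<le> dt * (x j * r j)" if j: "j \<in> B" for j
  proof -
    have "1 * (x j)\<^sup>2 \<le> (dt * lb) * (x j)\<^sup>2"
      using lb dt by (intro mult_right_mono) (auto simp: field_simps)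
    then show ?thesis
      unfolding bdry[OF j, symmetric] x_def by (simp add: power2_eq_square algebra_simps)
  qed
  have split: "(\<Sum>j\<in>V. f j) = (\<Sum>j\<in>J. f j) + (\<Sum>j\<in>B. f j)" for f :: "'v \<Rightarrow> real"
    using sum.union_disjoint[OF finite_inner finite_boundary disjoint] V_eq by metis
  have "(\<Sum>j\<in>J. \<Sum>k\<in>nb j. (x k)\<^sup>2) \<le> M * X\<^sup>2"
    unfolding X2 M_def by (rule sum_neighbors_le) simp
  then have "dt * Hp / (4 * d) * (\<Sum>j\<in>J. \<Sum>k\<in>nb j. (x k)\<^sup>2) \<le> dt * Hp / (4 * d) * (M * X\<^sup>2)"
    using dt d Hp_pos by (intro mult_left_mono) auto
  also have "\<dots> = c / 4 * X\<^sup>2" unfolding c_def by simp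
  finally have defect: "dt * Hp / (4 * d) * (\<Sum>j\<in>J. \<Sum>k\<in>nb j. (x k)\<^sup>2) \<le> c / 4 * X\<^sup>2" .
  have "X\<^sup>2 \<le> (\<Sum>j\<in>J. x j * e j + dt * (x j * r j) + dt * Hp / (4 * d) * (\<Sum>k\<in>nb j. (x k)\<^sup>2))
              + (\<Sum>j\<in>B. dt * (x j * r j))"
    unfolding X2 split using inner boundary by (intro add_mono sum_mono) auto
  also have "\<dots> = (\<Sum>j\<in>J. x j * e j) + dt * (\<Sum>j\<in>V. x j * r j)
                  + dt * Hp / (4 * d) * (\<Sum>j\<in>J. \<Sum>k\<in>nb j. (x k)\<^sup>2)"
    unfolding split by (simp add: sum.distrib sum_distrib_left algebra_simps)
  also have "\<dots> \<le> X * L2_set e J + dt * (X * L2_set r V) + c / 4 * X\<^sup>2"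
  proof (intro add_mono mult_left_mono)
    have "L2_set x J \<le> X" unfolding X_def using L2_set_subset finV V_eq by blast
    then have "L2_set x J * L2_set e J \<le> X * L2_set e J"
      by (intro mult_right_mono) (auto simp: L2_set_nonneg)
    then show "(\<Sum>j\<in>J. x j * e j) \<le> X * L2_set e J"
      using sum_mult_le_L2[of x e J] by linarith
    show "(\<Sum>j\<in>V. x j * r j) \<le> X * L2_set r V" unfolding X_def by (rule sum_mult_le_L2)
  qed (use dt defect in auto)
  finally have "X * ((1 - c / 4) * X) \<le> X * Y"
    unfolding Y_def by (simp add: algebra_simps power2_eq_square)
  then have energy: "(1 - c / 4) * X \<le> Y"
    using X0 Y0 by (cases "X = 0") auto
  \<comment> \<open>\<open>(1 - c / 4)\<^sup>2 - (1 - c) = c / 2 + c\<^sup>2 / 16\<close>\<close>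
  have "1 - c \<le> (1 - c / 4)\<^sup>2" using c0 by (simp add: power2_eq_square algebra_simps)
  then have "sqrt (1 - c) \<le> 1 - c / 4" using c1 by (intro real_le_lsqrt) auto
  then have "sqrt (1 - c) * X \<le> Y" using energy X0 by (meson mult_right_mono order_trans)
  then have "X \<le> sqrt (1 / (1 - c)) * Y"
    using c1 by (simp add: real_sqrt_divide field_simps)
  then show ?thesis unfolding X_def Y_def x_def c_def d_def M_def .
qed

end

section \<open>The error estimates\<close>

theorem theorem8:
  fixes V :: "'v set" and nb :: "'v \<Rightarrow> 'v set" and dx :: "'v \<Rightarrow> 'v \<Rightarrow> real"
    and H :: "'v \<Rightarrow> real \<Rightarrow> ('v \<Rightarrow> real) \<Rightarrow> real"
    and g ubar :: "'v \<times> nat \<Rightarrow> real"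
    and N :: nat and T dt lb l0 Hu Hp :: real
    and J B :: "'v set" and R :: "('v \<times> nat \<Rightarrow> real) \<Rightarrow> ('v \<times> nat \<Rightarrow> real)"
  assumes "finite V"
    and "\<And>j. j \<in> V \<Longrightarrow> nb j \<subseteq> V"
    and "\<And>j. j \<in> V \<Longrightarrow> j \<notin> nb j"
    and "J = inner_nodes V nb" and "J \<noteq> {}"
    and "B = boundary_nodes V nb" and "B \<noteq> {}"
    and "\<And>j k. j \<in> J \<Longrightarrow> k \<in> nb j \<Longrightarrow> dx j k > 0"
    and "N \<ge> 1" and "T > 0" and "dt = T / real N"
    and "lb > 0" and "l0 > 0"
    and "hamiltonian_lipschitz V nb H Hu Hp"
    and "hamiltonian_monotone V nb H"
    and "R = residual V nb dx H g N dt lb l0"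
    and "ubar \<in> extensional (space_time_index V nb N)"
    and "\<forall>i\<in>space_time_index V nb N. R ubar i = 0"
  shows
    "(\<forall>u\<in>extensional (space_time_index V nb N).
        linf_norm J (\<lambda>j. u (j, 0) - ubar (j, 0)) \<le> linf_norm J (\<lambda>j. u (j, 0) - g (j, 0)) \<and>
        (\<forall>n\<in>{1..N}.
           linf_norm V (\<lambda>j. u (j, n) - ubar (j, n))
             \<le> max (linf_norm J (\<lambda>j. u (j, 0) - g (j, 0)))
                   (MAX k\<in>{1..n}. linf_norm B (\<lambda>j. u (j, k) - g (j, k)))
               + (\<Sum>k=1..n. dt * linf_norm J (time_level (R u) k)))) \<and>
     (lb > 1 / dt \<longrightarrow>
      dt / dx_min V nb dx < 1 / (Hp * real (max_in_degree V nb)) \<longrightarrow>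
      (let \<gamma> = 1 / (1 - dt / dx_min V nb dx * Hp * real (max_in_degree V nb)) in
       \<forall>u\<in>extensional (space_time_index V nb N). \<forall>n\<in>{1..N}.
         L2_set (\<lambda>j. u (j, n) - ubar (j, n)) V
           \<le> sqrt \<gamma> * (L2_set (\<lambda>j. u (j, n - 1) - ubar (j, n - 1)) J
                       + dt * L2_set (time_level (R u) n) V)))"
proof -
  interpret monotone_graph_hamiltonian V nb dx H Hu Hp
    using assms by unfold_locales auto
  note J = \<open>J = inner_nodes V nb\<close> and B = \<open>B = boundary_nodes V nb\<close>
  have dt: "0 < dt" using assms by simp
  have index0: "(j, 0) \<in> space_time_index V nb N" if "j \<in> J" for j
    using that unfolding J space_time_index_def by simp
  have index: "(j, n) \<in> space_time_index V nb N" if "j \<in> V" "n \<in> {1..N}" for j n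
    using that unfolding space_time_index_def by simp
  have R_inner: "R u (j, n) = (u (j, n) - u (j, n - 1)) / dt + ham (time_level u n) j"
    if "j \<in> J" "n \<in> {1..N}" for u j n
    using that index[of j n] V_eq unfolding \<open>R = _\<close> residual_def J by (auto simp: time_level_def)
  have R_boundary: "R u (j, n) = lb * (u (j, n) - g (j, n))"
    if "j \<in> B" "n \<in> {1..N}" for u j n
    using that index[of j n] V_eq disjoint unfolding \<open>R = _\<close> residual_def B by auto
  have zero: "R ubar i = 0" if "i \<in> space_time_index V nb N" for i
    using that assms by blast
  have ubar0: "ubar (j, 0) = g (j, 0)" if "j \<in> J" for j
    using zero[OF index0[OF that]] index0[OF that] \<open>l0 > 0\<close> unfolding \<open>R = _\<close> residual_def by simp
  have ubarB: "ubar (j, n) = g (j, n)" if "j \<in> B" "n \<in> {1..N}" for j n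
  proof -
    have "j \<in> V" using that V_eq B by auto
    then show ?thesis
      using zero[OF index[OF _ that(2)]] R_boundary[OF that, of ubar] \<open>lb > 0\<close> by simp
  qed
  have step: "(time_level u n j - time_level ubar n j - (u (j, n - 1) - ubar (j, n - 1))) / dt
      + (ham (time_level u n) j - ham (time_level ubar n) j) = time_level (R u) n j"
    if j: "j \<in> J" and n: "n \<in> {1..N}" for u j n
  proof -
    have "R ubar (j, n) = 0" using zero index j n V_eq J by blast
    then show ?thesis using R_inner[OF j n, of u] R_inner[OF j n, of ubar]
      by (simp add: time_level_def diff_divide_distrib)
  qed
  have part_i: "linf_norm V (\<lambda>j. u (j, n) - ubar (j, n))
             \<le> max (linf_norm J (\<lambda>j. u (j, 0) - g (j, 0)))
                   (MAX k\<in>{1..n}. linf_norm B (\<lambda>j. u (j, k) - g (j, k)))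
               + (\<Sum>k=1..n. dt * linf_norm J (time_level (R u) k))"
    (is "_ \<le> ?C + _") if n: "n \<in> {1..N}" for u n
  proof -
    define S where "S m = (\<Sum>k=1..m. dt * linf_norm J (time_level (R u) k))" for m
    define E where "E W m = linf_norm W (\<lambda>j. u (j, m) - ubar (j, m))" for W m
    have finJ: "finite J" "J \<noteq> {}" using finite_inner inner_nonempty J by auto
    have "0 \<le> linf_norm J f" for f
      using finJ abs_le_linf_norm[of J _ f] by (metis abs_ge_zero all_not_in_conv order_trans)
    then have S0: "0 \<le> S m" for m unfolding S_def using dt by (intro sum_nonneg) auto
    \<comment> \<open>The constant \<open>?C\<close> keeps the final time \<open>n\<close>, so that it does not change along the induction.\<close>
    have step_V: "E V (Suc m) \<le> ?C + S (Suc m)" if m: "Suc m \<le> n" and IH: "E J m \<le> ?C + S m" for m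
    proof -
      have mN: "Suc m \<in> {1..N}" using m n by auto
      have "E V (Suc m) \<le> max (E B (Suc m))
              (E J m + dt * linf_norm J (time_level (R u) (Suc m)))"
        using linf_step[OF dt, of "time_level u (Suc m)" "time_level ubar (Suc m)"
            "\<lambda>j. u (j, m) - ubar (j, m)" "time_level (R u) (Suc m)"] step[OF _ mN, of _ u] J B
        by (simp add: E_def time_level_def)
      moreover have "E B (Suc m) \<le> ?C"
      proof -
        have "E B (Suc m) = linf_norm B (\<lambda>j. u (j, Suc m) - g (j, Suc m))"
          unfolding E_def using ubarB mN by (intro linf_norm_cong) auto
        also have "\<dots> \<le> (MAX k\<in>{1..n}. linf_norm B (\<lambda>j. u (j, k) - g (j, k)))"
          using m by (intro Max_ge) auto
        finally show ?thesis by simp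
      qed
      moreover have "S (Suc m) = S m + dt * linf_norm J (time_level (R u) (Suc m))"
        unfolding S_def by simp
      ultimately show ?thesis using IH S0[of "Suc m"] by linarith
    qed
    have E_J: "E J m \<le> ?C + S m" if "m \<le> n" for m
      using that
    proof (induction m)
      case 0
      have "E J 0 = linf_norm J (\<lambda>j. u (j, 0) - g (j, 0))"
        unfolding E_def using ubar0 by (intro linf_norm_cong) auto
      then show ?case unfolding S_def by simp
    next
      case (Suc m)
      have "E J (Suc m) \<le> E V (Suc m)"
        unfolding E_def using finV V_eq finJ J by (intro linf_norm_subset) auto
      then show ?case using step_V[of m] Suc by simp
    qed
    have "E V n \<le> ?C + S n" using step_V[of "n - 1"] E_J[of "n - 1"] n by simp
    then show ?thesis unfolding E_def S_def .
  qed
  have part_ii: "L2_set (\<lambda>j. u (j, n) - ubar (j, n)) V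
      \<le> sqrt (1 / (1 - dt / dx_min V nb dx * Hp * real (max_in_degree V nb)))
         * (L2_set (\<lambda>j. u (j, n - 1) - ubar (j, n - 1)) J + dt * L2_set (time_level (R u) n) V)"
    if lb: "lb > 1 / dt"
      and small: "dt / dx_min V nb dx < 1 / (Hp * real (max_in_degree V nb))"
      and n: "n \<in> {1..N}" for u n
  proof -
    have "lb * (time_level u n j - time_level ubar n j) = time_level (R u) n j" if "j \<in> B" for j
      using R_boundary[OF that n, of u] ubarB[OF that n] by (simp add: time_level_def)
    then show ?thesis
      using L2_step[OF dt lb small, of "time_level u n" "time_level ubar n"
          "\<lambda>j. u (j, n - 1) - ubar (j, n - 1)" "time_level (R u) n"] step[OF _ n, of _ u] J B
      by (simp add: time_level_def)
  qed
  have "linf_norm J (\<lambda>j. u (j, 0) - ubar (j, 0)) = linf_norm J (\<lambda>j. u (j, 0) - g (j, 0))"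
    for u :: "'v \<times> nat \<Rightarrow> real"
    using ubar0 by (intro linf_norm_cong) auto
  then show ?thesis using part_i part_ii unfolding Let_def by (intro conjI ballI impI) simp_all
qed

end
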